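(* Let $\mathcal{R}$ be a $\ast$-ring and let $a\in\mathcal{R}$. Then the following are equivalent: (i) $a$ is right pseudo core invertible; (ii) $a^k$ is right core invertible for some positive integer $k$.
   Context: A $\ast$-ring is an associative ring $\mathcal{R}$ with identity $1$ equipped with an involution, i.e. a map $\ast:\mathcal{R}\to\mathcal{R}$ with $(a^\ast)^\ast=a$, $(a+b)^\ast=a^\ast+b^\ast$, $(ab)^\ast=b^\ast a^\ast$ for all $a,b\in\mathcal{R}$. An element $a\in\mathcal{R}$ is right core invertible if $a^\ast\in a^\ast a^2\mathcal{R}$, equivalently if there exists $x\in a\mathcal{R}$ with $a^\ast a x=a^\ast$; any such $x$ is called a right core inverse of $a$ (not necessarily unique). An element $a\in\mathcal{R}$ is right pseudo core invertible if there exist $x\in\mathcal{R}$ and a positive integer $k$ such that $axa^k=a^k$, $x=ax^2$ and $(ax)^\ast=ax$; any such $x$ is called a right pseudo core inverse of $a$. *)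

theory Defs
  imports Main
begin

(* The superclass is ring + monoid_mult rather than ring_1, because ring_1 also
   demands 0 ~= 1 and would exclude the zero ring. *)
class star_ring = ring + monoid_mult +
  fixes star :: "'a \<Rightarrow> 'a"
  assumes star_star: "star (star a) = a"
    and star_add: "star (a + b) = star a + star b"
    and star_mult: "star (a * b) = star b * star a"

definition right_core_invertible :: "'a::star_ring \<Rightarrow> bool" where
  "right_core_invertible a \<longleftrightarrow> star a \<in> {star a * a ^ 2 * r | r. True}"

definition right_core_inverse :: "'a::star_ring \<Rightarrow> 'a \<Rightarrow> bool" where
  "right_core_inverse a x \<longleftrightarrow> x \<in> {a * r | r. True} \<and> star a * a * x = star a"

lemma right_core_invertible_iff_inverse:
  "right_core_invertible a \<longleftrightarrow> (\<exists>x. right_core_inverse a x)"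
  unfolding right_core_invertible_def right_core_inverse_def
  by (auto simp: power2_eq_square mult.assoc) metis+

definition right_pseudo_core_inverse :: "'a::star_ring \<Rightarrow> 'a \<Rightarrow> bool" where
  "right_pseudo_core_inverse a x \<longleftrightarrow>
     (\<exists>k::nat. k > 0 \<and> a * x * a ^ k = a ^ k \<and> x = a * x ^ 2 \<and> star (a * x) = a * x)"

definition right_pseudo_core_invertible :: "'a::star_ring \<Rightarrow> bool" where
  "right_pseudo_core_invertible a \<longleftrightarrow> (\<exists>x. right_pseudo_core_inverse a x)"

end

(* If x is a right pseudo core inverse of a with exponent k, then x = a x^2 gives
   a x = a^k x^k and x^k = a^k x^(2k), so x^k is a right core inverse of a^k.
   Conversely, if y is a right core inverse of b = a^k, then b y is self-adjoint with
   b y b = b, and a^(k-1) y is a right pseudo core inverse of a. *)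
theory Submission
  imports Defs
begin

text \<open>Substituting \<open>a * x ^ 2\<close> for \<open>x\<close> repeatedly adds one
  \<open>a\<close> on the left and one \<open>x\<close> on the right each time.\<close>

lemma mult_power_power_Suc_eq:
  fixes a x :: "'a::monoid_mult"
  assumes "x = a * x ^ 2"
  shows "a ^ n * x ^ Suc n = x"
proof (induction n)
  case (Suc n)
  have "a ^ Suc n * x ^ Suc (Suc n) = a ^ n * (a * x ^ 2) * x ^ n"
    by (simp only: power_Suc2[of a] power_Suc[of x] power2_eq_square mult.assoc)
  also have "\<dots> = a ^ n * x ^ Suc n"
    using assms by (simp add: mult.assoc)
  finally show ?case
    using Suc.IH by simp
qed simp

text \<open>Multiplying \<open>star b = star b * b * y\<close> on the left by \<open>star y\<close>
  gives \<open>star p = star p * p\<close> for \<open>p = b * y\<close>, and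
  \<open>star p * p\<close> is self-adjoint.\<close>

lemma right_core_inverse_self_adjoint:
  fixes b y :: "'a::star_ring"
  assumes "right_core_inverse b y"
  shows "star (b * y) = b * y"
proof -
  have "star b = star b * b * y"
    using assms by (simp add: right_core_inverse_def)
  then have *: "star (b * y) = star (b * y) * (b * y)"
    by (metis star_mult mult.assoc)
  then show ?thesis
    by (metis star_mult star_star)
qed

text \<open>Applying \<open>star\<close> to the defining equation gives
  \<open>star (b * y) * b = b\<close>, and \<open>b * y\<close> is self-adjoint.\<close>

lemma right_core_inverse_inner:
  fixes b y :: "'a::star_ring"
  assumes "right_core_inverse b y"
  shows "b * y * b = b"
proof -
  have "star b * (b * y) = star b"
    using assms by (simp add: right_core_inverse_def mult.assoc)
  then have "star (b * y) * b = b"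
    by (metis star_mult star_star)
  then show ?thesis
    by (simp add: right_core_inverse_self_adjoint[OF assms])
qed

lemma right_core_inverse_power:
  fixes a x :: "'a::star_ring"
  assumes "k > 0" and inner: "a * x * a ^ k = a ^ k" and outer: "x = a * x ^ 2"
    and adj: "star (a * x) = a * x"
  shows "right_core_inverse (a ^ k) (x ^ k)"
proof -
  obtain m where k: "k = Suc m"
    using \<open>k > 0\<close> gr0_implies_Suc by blast
  have "a ^ k * x ^ k = a * (a ^ m * x ^ Suc m)"
    by (simp add: k mult.assoc)
  then have ax: "a ^ k * x ^ k = a * x"
    by (simp only: mult_power_power_Suc_eq[OF outer])
  \<comment> \<open>Only the first factor of \<open>x ^ k = x * x ^ m\<close> is expanded; this
    exhibits \<open>x ^ k\<close> as a right multiple of \<open>a ^ k\<close>.\<close>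
  have "x ^ k = a ^ k * x ^ Suc k * x ^ m"
    by (subst mult_power_power_Suc_eq[OF outer]) (simp add: k)
  then have "x ^ k = a ^ k * (x ^ Suc k * x ^ m)"
    by (simp only: mult.assoc)
  \<comment> \<open>This is the adjoint of \<open>inner\<close>.\<close>
  moreover have "star (a ^ k) * (a * x) = star (a ^ k)"
    by (metis inner adj star_mult)
  ultimately show ?thesis
    by (auto simp: right_core_inverse_def mult.assoc ax)
qed

lemma right_pseudo_core_inverse_of_power:
  fixes a y :: "'a::star_ring"
  assumes "right_core_inverse (a ^ Suc m) y"
  shows "right_pseudo_core_inverse a (a ^ m * y)"
proof -
  define b where "b = a ^ Suc m"
  obtain r where r: "y = b * r"
    using assms by (auto simp: right_core_inverse_def b_def)
  have inner: "b * y * b = b"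
    using right_core_inverse_inner[OF assms] by (simp add: b_def)
  \<comment> \<open>Both factors are powers of \<open>a\<close>. Commuting them brings the
    \<open>b\<close> of \<open>y = b * r\<close> next to \<open>b * y\<close>, where
    \<open>inner\<close> absorbs \<open>b * y\<close>.\<close>
  have comm: "a ^ m * b = b * a ^ m"
    unfolding b_def by (simp only: flip: power_add) (simp add: add.commute)
  have ax: "a * (a ^ m * y) = b * y"
    by (simp add: b_def mult.assoc)
  have "a * (a ^ m * y) ^ 2 = b * y * (a ^ m * b) * r"
    using ax r by (simp add: power2_eq_square flip: mult.assoc)
  also have "\<dots> = b * y * b * a ^ m * r"
    by (simp add: comm mult.assoc)
  also have "\<dots> = a ^ m * y"
    by (simp only: inner flip: comm) (simp only: r mult.assoc)
  finally have outer: "a ^ m * y = a * (a ^ m * y) ^ 2" ..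
  have "star (b * y) = b * y"
    using right_core_inverse_self_adjoint[OF assms] by (simp add: b_def)
  \<comment> \<open>The exponent \<open>Suc m\<close> serves as witness: by \<open>ax\<close>, its
    condition is exactly \<open>inner\<close>.\<close>
  then show ?thesis
    unfolding right_pseudo_core_inverse_def
    using outer inner ax b_def by (metis zero_less_Suc)
qed

theorem theorem4p8:
  fixes a :: "'a::star_ring"
  shows "right_pseudo_core_invertible a \<longleftrightarrow> (\<exists>k::nat. k > 0 \<and> right_core_invertible (a ^ k))"
proof
  assume "right_pseudo_core_invertible a"
  then show "\<exists>k::nat. k > 0 \<and> right_core_invertible (a ^ k)"
    unfolding right_pseudo_core_invertible_def right_pseudo_core_inverse_def
      right_core_invertible_iff_inverse
    using right_core_inverse_power by blast
next
  assume "\<exists>k::nat. k > 0 \<and> right_core_invertible (a ^ k)"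
  then show "right_pseudo_core_invertible a"
    unfolding right_pseudo_core_invertible_def right_core_invertible_iff_inverse
    using right_pseudo_core_inverse_of_power by (metis gr0_implies_Suc)
qed

end
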